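(* For every odd $k\geq3$ and every even $d\geq2$ there exists a Cayley digraph of order $2k\left(\frac{d}{2}\right)^k$, degree $d$ and diameter at most $k$.
   Context: A Cayley digraph $Cay(\Gamma,X)$ of a group $\Gamma$ with respect to a generating set $X$ not containing the identity has vertex set $\Gamma$ and an arc from $u$ to $v$ iff $ux=v$ for some $x\in X$; its degree is $|X|$ and its order is $|\Gamma|$. The diameter is the maximum directed distance between vertices. *)

theory Defs
  imports
    "HOL-Algebra.Generated_Groups"
    "Graph_Theory.Shortest_Path"
begin

definition cayley_digraph :: "('a, 'm) monoid_scheme \<Rightarrow> 'a set \<Rightarrow> ('a, 'a \<times> 'a) pre_digraph" where
  "cayley_digraph G X =
     \<lparr> verts = carrier G,
       arcs = {(u, v). u \<in> carrier G \<and> v \<in> carrier G \<and> (\<exists>x\<in>X. u \<otimes>\<^bsub>G\<^esub> x = v)},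
       tail = fst,
       head = snd \<rparr>"

lemma wf_cayley_digraph: "wf_digraph (cayley_digraph G X)"
  by unfold_locales (auto simp: cayley_digraph_def)

text \<open>With unit arc costs the cost of a walk is its length. The library constant below is an
  infimum over walks in \<^typ>\<open>ereal\<close>, hence \<open>\<infinity>\<close> if \<open>v\<close> is not reachable from \<open>u\<close>.\<close>

definition directed_dist :: "('a, 'b) pre_digraph \<Rightarrow> 'a \<Rightarrow> 'a \<Rightarrow> ereal" where
  "directed_dist D u v = wf_digraph.\<mu> D (\<lambda>_. 1) u v"

definition digraph_diameter :: "('a, 'b) pre_digraph \<Rightarrow> ereal" where
  "digraph_diameter D = (SUP (u, v) \<in> verts D \<times> verts D. directed_dist D u v)"

text \<open>Every finite group has an isomorphic copy whose carrier is a set of natural numbers, so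
  existence statements about finite groups may be stated for \<^typ>\<open>nat monoid\<close>.\<close>

end

theory Submission
  imports Defs "HOL-Algebra.Weak_Morphisms"
begin

text \<open>Let \<open>k = 2 * n + 1\<close> and \<open>m = d div 2\<close>. The group is the semidirect product of \<open>(\<int>/m)^k\<close> with the
  dihedral group of order \<open>2 * k\<close>, which permutes the coordinates \<open>y \<in> \<int>/k\<close>. The generators are
  \<open>(x \<delta>\<^sub>0, y \<mapsto> y + 2)\<close> and \<open>(x (\<delta>\<^sub>0 + \<delta>\<^sub>1), y \<mapsto> - 1 - y)\<close> with \<open>x \<in> \<int>/m\<close>. A product of \<open>k\<close> generators
  is governed by a word in the two types. Draw a root at \<open>c\<close> for every letter of the first type read at
  \<open>y \<mapsto> c + e * y\<close>, and an edge between the neighbouring coordinates \<open>c\<close> and \<open>c + e\<close> for every letter of the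
  second type. If every coordinate is joined to a root by edges, then the letters' vectors span
  \<open>(\<int>/m)^k\<close>, so all elements over the endpoint of the word are products of \<open>k\<close> generators. It remains to
  give, for each of the \<open>2 * k\<close> dihedral elements, such a word of length \<open>k\<close> ending there.\<close>

section \<open>Diameters of Cayley digraphs from products of generators\<close>

lemma (in group) foldl_mult:
  assumes "u \<in> carrier G" "v \<in> carrier G" "set xs \<subseteq> carrier G"
  shows "foldl (\<otimes>) (u \<otimes> v) xs = u \<otimes> foldl (\<otimes>) v xs"
  using assms by (induction xs arbitrary: v) (auto simp: m_assoc)

lemma foldl_in_generate:
  assumes "u \<in> generate G X" "set xs \<subseteq> X"
  shows "foldl (\<otimes>\<^bsub>G\<^esub>) u xs \<in> generate G X"
  using assms
proof (induction xs arbitrary: u)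
  case (Cons x xs)
  then have "u \<otimes>\<^bsub>G\<^esub> x \<in> generate G X"
    by (auto intro: generate.intros)
  with Cons show ?case by simp
qed simp

lemma (in monoid) cayley_digraph_walk:
  assumes "X \<subseteq> carrier G" "u \<in> carrier G" "set xs \<subseteq> X"
  shows "\<exists>p. pre_digraph.awalk (cayley_digraph G X) u p (foldl (\<otimes>) u xs) \<and> length p = length xs"
  using assms(2,3)
proof (induction xs arbitrary: u)
  case Nil
  then have "pre_digraph.awalk (cayley_digraph G X) u [] (foldl (\<otimes>) u [])"
    by (simp add: pre_digraph.awalk_def pre_digraph.cas.simps cayley_digraph_def)
  then show ?case by (metis list.size(3))
next
  case (Cons x xs)
  then have ux: "x \<in> X" "u \<otimes> x \<in> carrier G"
    using assms(1) by auto
  from Cons.IH[OF ux(2)] Cons.prems obtain p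
    where "pre_digraph.awalk (cayley_digraph G X) (u \<otimes> x) p (foldl (\<otimes>) u (x # xs))"
      and "length p = length xs"
    by auto
  with ux Cons.prems
  have "pre_digraph.awalk (cayley_digraph G X) u ((u, u \<otimes> x) # p) (foldl (\<otimes>) u (x # xs))"
    by (auto simp: pre_digraph.awalk_def pre_digraph.cas.simps cayley_digraph_def)
  with \<open>length p = length xs\<close> show ?case
    by (metis length_Cons)
qed

lemma (in monoid) cayley_digraph_diameter_le:
  assumes "X \<subseteq> carrier G"
    and words: "\<And>u v. u \<in> carrier G \<Longrightarrow> v \<in> carrier G \<Longrightarrow>
      \<exists>xs. length xs \<le> k \<and> set xs \<subseteq> X \<and> foldl (\<otimes>) u xs = v"
  shows "digraph_diameter (cayley_digraph G X) \<le> ereal (real k)"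
proof -
  have "directed_dist (cayley_digraph G X) u v \<le> ereal (real k)"
    if uv: "u \<in> carrier G" "v \<in> carrier G" for u v
  proof -
    from words[OF uv] obtain xs where xs: "length xs \<le> k" "set xs \<subseteq> X" "foldl (\<otimes>) u xs = v"
      by blast
    with cayley_digraph_walk[OF assms(1) uv(1)] obtain p
      where p: "pre_digraph.awalk (cayley_digraph G X) u p v" "length p = length xs"
      by blast
    have "wf_digraph.awalk_cost (\<lambda>_. 1) p = real (length p)"
      by (simp add: wf_digraph.awalk_cost_def[OF wf_cayley_digraph] sum_list_triv)
    with wf_digraph.min_cost_le_walk_cost[OF wf_cayley_digraph p(1), of "\<lambda>_. 1"] p(2) xs(1)
    show ?thesis
      unfolding directed_dist_def by (metis ereal_less_eq(3) of_nat_le_iff order_trans)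
  qed
  then show ?thesis
    unfolding digraph_diameter_def
    by (auto intro!: SUP_least simp: cayley_digraph_def)
qed

lemma hom_foldl:
  assumes "monoid G" "f \<in> hom G H" "u \<in> carrier G" "set xs \<subseteq> carrier G"
  shows "foldl (\<otimes>\<^bsub>H\<^esub>) (f u) (map f xs) = f (foldl (\<otimes>\<^bsub>G\<^esub>) u xs)"
  using assms(3,4)
proof (induction xs arbitrary: u)
  case (Cons x xs)
  then have "f (u \<otimes>\<^bsub>G\<^esub> x) = f u \<otimes>\<^bsub>H\<^esub> f x" "u \<otimes>\<^bsub>G\<^esub> x \<in> carrier G"
    using assms(1,2) by (auto simp: hom_def monoid.m_closed)
  with Cons.IH[of "u \<otimes>\<^bsub>G\<^esub> x"] Cons.prems show ?case by simp
qed simp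

text \<open>Words starting at the identity suffice because left translations preserve arcs. The
  group is transported along an injection of its finite carrier into \<open>nat\<close>, the type
  over which the theorem quantifies.\<close>

lemma (in group) nat_cayley_digraph_of_words:
  assumes fin: "finite (carrier G)" and X: "X \<subseteq> carrier G" "\<one> \<notin> X"
    and words: "\<And>v. v \<in> carrier G \<Longrightarrow>
      \<exists>xs. length xs \<le> k \<and> set xs \<subseteq> X \<and> foldl (\<otimes>) \<one> xs = v"
  shows "\<exists>(\<Gamma> :: nat monoid) Y.
           group \<Gamma> \<and> finite (carrier \<Gamma>) \<and>
           Y \<subseteq> carrier \<Gamma> \<and> generate \<Gamma> Y = carrier \<Gamma> \<and> \<one>\<^bsub>\<Gamma>\<^esub> \<notin> Y \<and>
           order \<Gamma> = order G \<and> card Y = card X \<and>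
           digraph_diameter (cayley_digraph \<Gamma> Y) \<le> ereal (real k)"
proof -
  from finite_imp_inj_to_nat_seg[OF fin] obtain f :: "'a \<Rightarrow> nat" where f: "inj_on f (carrier G)"
    by blast
  define \<Gamma> where "\<Gamma> = image_group f G"
  have carrier: "carrier \<Gamma> = f ` carrier G" and one: "\<one>\<^bsub>\<Gamma>\<^esub> = f \<one>"
    by (simp_all add: \<Gamma>_def image_group_def)
  interpret \<Gamma>: group \<Gamma>
    unfolding \<Gamma>_def using f by (rule inj_imp_image_group_is_group)
  have hom: "f \<in> hom G \<Gamma>"
    using inj_imp_image_group_iso[OF f] by (simp add: \<Gamma>_def iso_def)
  have Y: "f ` X \<subseteq> carrier \<Gamma>"
    using X carrier by auto
  have words': "\<exists>ys. length ys \<le> k \<and> set ys \<subseteq> f ` X \<and> foldl (\<otimes>\<^bsub>\<Gamma>\<^esub>) u ys = v"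
    if uv: "u \<in> carrier \<Gamma>" "v \<in> carrier \<Gamma>" for u v
  proof -
    from uv obtain a b where ab: "a \<in> carrier G" "u = f a" "b \<in> carrier G" "v = f b"
      by (auto simp: carrier)
    \<comment> \<open>Arcs multiply on the right, so a word leading from the identity to the
      quotient of \<open>a\<close> and \<open>b\<close> leads from \<open>a\<close> to
      \<open>b\<close>.\<close>
    obtain xs where xs: "length xs \<le> k" "set xs \<subseteq> X" "foldl (\<otimes>) \<one> xs = inv a \<otimes> b"
      using words[of "inv a \<otimes> b"] ab by auto
    have "foldl (\<otimes>) a xs = b"
      using foldl_mult[of a \<one> xs] xs X ab by (simp add: inv_solve_left' subset_trans flip: m_assoc)
    then have "foldl (\<otimes>\<^bsub>\<Gamma>\<^esub>) u (map f xs) = v"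
      using hom_foldl[OF monoid_axioms hom ab(1), of xs] xs X ab by auto
    with xs show ?thesis
      by (intro exI[of _ "map f xs"]) auto
  qed
  have "carrier \<Gamma> \<subseteq> generate \<Gamma> (f ` X)"
    using words'[OF \<Gamma>.one_closed] foldl_in_generate[OF generate.one] by blast
  then have "generate \<Gamma> (f ` X) = carrier \<Gamma>"
    using \<Gamma>.generate_incl[OF Y] by blast
  moreover have "\<one>\<^bsub>\<Gamma>\<^esub> \<notin> f ` X"
    unfolding one using X f by (auto dest: inj_onD)
  moreover have "order \<Gamma> = order G" "card (f ` X) = card X"
    using f X(1) by (auto simp: order_def carrier card_image inj_on_subset)
  moreover have "finite (carrier \<Gamma>)"
    using fin carrier by simp
  moreover have "digraph_diameter (cayley_digraph \<Gamma> (f ` X)) \<le> ereal (real k)"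
    using Y words' by (rule \<Gamma>.cayley_digraph_diameter_le)
  ultimately show ?thesis
    using \<Gamma>.is_group Y by (intro exI[of _ \<Gamma>] exI[of _ "f ` X"] conjI)
qed

section \<open>Words in the dihedral group\<close>

datatype letter = Rot | Flip

text \<open>A pair \<open>(c, e)\<close> with \<open>e = 1\<close> or \<open>e = -1\<close> stands for the map \<open>y \<mapsto> c + e * y\<close> of the integers
  modulo \<open>k\<close>; \<^const>\<open>Rot\<close> and \<^const>\<open>Flip\<close> stand for \<open>y \<mapsto> y + 2\<close> and \<open>y \<mapsto> - 1 - y\<close>.\<close>

definition delta :: "int \<Rightarrow> int \<Rightarrow> int \<Rightarrow> int" where
  "delta k z y = of_bool (k dvd y - z)"

fun move :: "letter \<Rightarrow> int \<times> int \<Rightarrow> int \<times> int" where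
  "move Rot (c, e) = (c + 2 * e, e)"
| "move Flip (c, e) = (c - e, - e)"

fun item :: "int \<Rightarrow> letter \<Rightarrow> int \<times> int \<Rightarrow> int \<Rightarrow> int" where
  "item k Rot (c, e) y = delta k c y"
| "item k Flip (c, e) y = delta k c y + delta k (c + e) y"

text \<open>All vectors that appear as the first component of a product of generators spelling the word \<open>w\<close>,
  starting at the dihedral element \<open>q\<close>.\<close>

fun labels :: "int \<Rightarrow> letter list \<Rightarrow> int \<times> int \<Rightarrow> (int \<Rightarrow> int) set" where
  "labels k [] q = {\<lambda>_. 0}"
| "labels k (l # w) q = {\<lambda>y. x * item k l q y + f y | x f. f \<in> labels k w (move l q)}"

section \<open>Vectors obtained along a fixed word, and the coordinates they cover\<close>

lemma labels_ConsI:
  assumes "f \<in> labels k w (move l q)"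
  shows "(\<lambda>y. x * item k l q y + f y) \<in> labels k (l # w) q"
  using assms unfolding labels.simps by blast

lemma labels_ConsE:
  assumes "f \<in> labels k (l # w) q"
  obtains x g where "f = (\<lambda>y. x * item k l q y + g y)" "g \<in> labels k w (move l q)"
  using assms unfolding labels.simps by blast

text \<open>The dihedral positions along \<open>w\<close> depend on the letter types only, so the
  coefficients can be combined letter by letter. Together with the zero vector this makes the labels
  of a fixed word a module over the integers.\<close>

lemma labels_add_mult:
  assumes "f \<in> labels k w q" "g \<in> labels k w q"
  shows "(\<lambda>y. f y + t * g y) \<in> labels k w q"
  using assms
proof (induction w arbitrary: f g q)
  case Nil
  then show ?case by simp
next
  case (Cons l w)
  obtain x f' where f: "f = (\<lambda>y. x * item k l q y + f' y)" "f' \<in> labels k w (move l q)"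
    using Cons.prems(1) by (rule labels_ConsE)
  obtain x' g' where g: "g = (\<lambda>y. x' * item k l q y + g' y)" "g' \<in> labels k w (move l q)"
    using Cons.prems(2) by (rule labels_ConsE)
  have "(\<lambda>y. f' y + t * g' y) \<in> labels k w (move l q)"
    using f(2) g(2) by (rule Cons.IH)
  from labels_ConsI[OF this, of "x + t * x'"] show ?case
    by (simp only: f(1) g(1) algebra_simps)
qed

lemma zero_in_labels: "(\<lambda>_. 0) \<in> labels k w q"
proof (induction w arbitrary: q)
  case (Cons l w)
  from labels_ConsI[OF Cons.IH, of 0] show ?case
    by (simp only: mult_zero_left add_0)
qed simp

text \<open>The letters of \<open>w'\<close> receive coefficient 0. With
  \<open>labels_append_right\<close> this lets each segment of a word be studied separately.\<close>

lemma labels_append_left: "labels k w q \<subseteq> labels k (w @ w') q"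
proof (induction w arbitrary: q)
  case Nil
  show ?case using zero_in_labels by auto
next
  case (Cons l w)
  then show ?case
    by (fastforce elim!: labels_ConsE intro: labels_ConsI simp del: labels.simps)
qed

lemma labels_Cons_tail: "labels k w (move l q) \<subseteq> labels k (l # w) q"
proof
  fix f assume "f \<in> labels k w (move l q)"
  from labels_ConsI[OF this, of 0] show "f \<in> labels k (l # w) q"
    by (simp del: labels.simps)
qed

lemma labels_append_right: "labels k w' (fold move w q) \<subseteq> labels k (w @ w') q"
proof (induction w arbitrary: q)
  case (Cons l w)
  from order_trans[OF Cons.IH labels_Cons_tail] show ?case
    by (simp del: labels.simps)
qed simp

lemma item_in_labels: "item k l q \<in> labels k (l # w) q"
  using labels_ConsI[OF zero_in_labels, of 1] by (simp del: labels.simps)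

text \<open>Membership in the span replaces being joined to a root, so no graph has to be built:
  \<open>covers_Rot\<close> supplies the roots and \<open>covers_Flip_iff\<close> the edges.\<close>

definition covers :: "int \<Rightarrow> letter list \<Rightarrow> int \<times> int \<Rightarrow> int \<Rightarrow> bool" where
  "covers k w q z \<longleftrightarrow> delta k z \<in> labels k w q"

lemma covers_appendI1: "covers k w q z \<Longrightarrow> covers k (w @ w') q z"
  unfolding covers_def using labels_append_left by blast

lemma covers_appendI2: "covers k w' (fold move w q) z \<Longrightarrow> covers k (w @ w') q z"
  unfolding covers_def using labels_append_right by blast

lemma covers_mid: "covers k w2 (fold move w1 q) z \<Longrightarrow> covers k (w1 @ w2 @ w3) q z"
  by (intro covers_appendI2 covers_appendI1)

lemma covers_mid2:
  "covers k w3 (fold move w2 (fold move w1 q)) z \<Longrightarrow> covers k (w1 @ w2 @ w3 @ w4) q z"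
  by (rule covers_appendI2, rule covers_mid)

text \<open>Positions can therefore stay unreduced integers, and wrapping around modulo
  \<open>k\<close> is invoked only where a coordinate has to be identified.\<close>

lemma delta_cong: "k dvd z - z' \<Longrightarrow> delta k z = delta k z'"
proof -
  assume a: "k dvd z - z'"
  have "k dvd y - z \<longleftrightarrow> k dvd y - z'" for y
    using dvd_add_right_iff[OF a, of "y - z"] by simp
  then show ?thesis by (auto simp: delta_def fun_eq_iff)
qed

lemma covers_cong: "covers k w q z' \<Longrightarrow> k dvd z - z' \<Longrightarrow> covers k w q z"
  by (simp add: covers_def delta_cong)

lemma covers_Rot: "covers k (Rot # w) (c, e) c"
proof -
  have "item k Rot (c, e) = delta k c" by (simp add: fun_eq_iff)
  then show ?thesis
    using item_in_labels[of k Rot "(c, e)" w] by (simp add: covers_def)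
qed

text \<open>Subtracting the vector of the covered end from the edge vector leaves the vector of the
  other end.\<close>

lemma edge_in_labels:
  assumes "(\<lambda>y. delta k a y + delta k b y) \<in> labels k w q" "covers k w q a"
  shows "covers k w q b"
  using labels_add_mult[OF assms(1), of "delta k a" "-1"] assms(2)
  by (simp add: covers_def)

lemma covers_Flip_iff:
  assumes "fold move w q = (c, e)"
  shows "covers k (w @ Flip # w') q (c + e) \<longleftrightarrow> covers k (w @ Flip # w') q c"
proof -
  have item: "item k Flip (c, e) \<in> labels k (w @ Flip # w') q"
    using item_in_labels[of k Flip "(c, e)" w'] labels_append_right[of k "Flip # w'" w q] assms by auto
  have "item k Flip (c, e) = (\<lambda>y. delta k c y + delta k (c + e) y)"
    by (simp add: fun_eq_iff)
  with item have edge: "(\<lambda>y. delta k c y + delta k (c + e) y) \<in> labels k (w @ Flip # w') q"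
    by (simp only:)
  have "item k Flip (c, e) = (\<lambda>y. delta k (c + e) y + delta k c y)"
    by (simp add: fun_eq_iff)
  with item have edge': "(\<lambda>y. delta k (c + e) y + delta k c y) \<in> labels k (w @ Flip # w') q"
    by (simp only:)
  show ?thesis
    using edge_in_labels[OF edge] edge_in_labels[OF edge'] by blast
qed

section \<open>Runs of rotations and blocks of four letters\<close>

lemma funpow_move_Rot: "(move Rot ^^ n) (c, e) = (c + 2 * int n * e, e)"
  by (induction n) (auto simp: algebra_simps)

lemma covers_replicate_Rot: "i < n \<Longrightarrow> covers k (replicate n Rot) (c, e) (c + 2 * int i * e)"
proof (induction n arbitrary: i c)
  case (Suc n)
  show ?case
  proof (cases i)
    case 0
    then show ?thesis using covers_Rot by simp
  next
    case (Suc j)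
    then have "covers k (replicate n Rot) (c + 2 * e, e) (c + 2 * e + 2 * int j * e)"
      using Suc.IH Suc.prems by simp
    then show ?thesis
      using covers_appendI2[of k "replicate n Rot" "[Rot]" "(c, e)"] Suc by (simp add: algebra_simps)
  qed
qed simp

definition blocks :: "nat \<Rightarrow> letter list" where
  "blocks s = concat (replicate s [Rot, Flip, Flip, Rot])"

lemma length_blocks: "length (blocks s) = 4 * s"
  by (induction s) (auto simp: blocks_def)

lemma blocks_Suc: "blocks (Suc s) = [Rot, Flip, Flip, Rot] @ blocks s"
  by (simp add: blocks_def)

text \<open>A block \<open>Rot, Flip, Flip, Rot\<close> covers four consecutive coordinates and moves on by four, whereas
  \<open>Rot, Rot\<close> covers only every second one.\<close>

lemma fold_move_blocks: "fold move (blocks s) (c, e) = (c + 4 * int s * e, e)"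
  by (induction s arbitrary: c) (auto simp: blocks_def algebra_simps)

text \<open>The two \<open>Rot\<close> letters put roots at \<open>c\<close> and
  \<open>c + 2 * e\<close>. The two \<open>Flip\<close> letters put edges between
  \<open>c + 2 * e\<close> and \<open>c + 3 * e\<close> and between \<open>c + e\<close> and
  \<open>c\<close>.\<close>

lemma covers_block: "\<forall>j \<in> {0, 1, 2, 3}. covers k [Rot, Flip, Flip, Rot] (c, e) (c + j * e)"
proof -
  have 0: "covers k [Rot, Flip, Flip, Rot] (c, e) c"
    by (rule covers_Rot)
  have "covers k ([Rot, Flip, Flip] @ [Rot]) (c, e) (c + 2 * e)"
    using covers_Rot[of k "[]" "c + 2 * e" e] by (intro covers_appendI2) (simp add: algebra_simps)
  then have 2: "covers k [Rot, Flip, Flip, Rot] (c, e) (c + 2 * e)"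
    by simp
  have 1: "covers k [Rot, Flip, Flip, Rot] (c, e) (c + e)"
    using covers_Flip_iff[of "[Rot, Flip]" "(c, e)" "c + e" "- e" k "[Rot]"] 0 by simp
  have 3: "covers k [Rot, Flip, Flip, Rot] (c, e) (c + 3 * e)"
    using covers_Flip_iff[of "[Rot]" "(c, e)" "c + 2 * e" e k "[Flip, Rot]"] 2
    by (simp add: algebra_simps)
  from 0 1 2 3 show ?thesis by simp
qed

lemma covers_blocks: "j < 4 * s \<Longrightarrow> covers k (blocks s) (c, e) (c + int j * e)"
proof (induction s arbitrary: j c)
  case (Suc s)
  show ?case
  proof (cases "j < 4")
    case True
    then have "int j \<in> {0, 1, 2, 3}" by auto
    then show ?thesis
      unfolding blocks_Suc by (rule covers_block[THEN bspec, THEN covers_appendI1])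
  next
    case False
    then obtain i where i: "j = 4 + i"
      using le_Suc_ex[of 4 j] by auto
    have move: "fold move [Rot, Flip, Flip, Rot] (c, e) = (c + 4 * e, e)"
      by simp
    have "covers k (blocks s) (c + 4 * e, e) (c + 4 * e + int i * e)"
      using Suc.prems i by (intro Suc.IH) simp
    moreover have "c + 4 * e + int i * e = c + int j * e"
      by (simp add: i algebra_simps)
    ultimately show ?thesis
      unfolding blocks_Suc by (intro covers_appendI2) (simp only: move)
  qed
qed (simp add: blocks_def)

section \<open>Four families of spanning words\<close>

lemma covers_shift:
  assumes "covers k w q z'" "z = z' + t * k"
  shows "covers k w q z"
  using assms by (auto intro: covers_cong)

text \<open>Runs of \<open>Rot\<close> advance by two and change parity only by wrapping around the
  odd modulus, so even and odd residues are checked separately.\<close>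

lemma covers_allI:
  assumes k: "k = 2 * int n + 1"
    and even: "\<And>i. i \<le> n \<Longrightarrow> covers k w q (2 * int i)"
    and odd: "\<And>i. i < n \<Longrightarrow> covers k w q (2 * int i + 1)"
  shows "covers k w q z"
proof -
  define r where "r = nat (z mod k)"
  have r: "int r = z mod k" "r < 2 * n + 1"
    unfolding r_def using k pos_mod_bound[of k z] pos_mod_sign[of k z] by linarith+
  have "covers k w q (int r)"
  proof (cases "Parity.even r")
    case True
    then obtain i where "r = 2 * i" by (rule evenE)
    with r even[of i] show ?thesis by simp
  next
    case False
    then obtain i where "r = 2 * i + 1" by (rule oddE)
    with r odd[of i] show ?thesis by (simp add: add.commute)
  qed
  then show ?thesis
    by (rule covers_shift[of _ _ _ _ _ "z div k"]) (simp add: r)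
qed

text \<open>The length equals the number of coordinates to be covered, so no letter may contribute a
  redundant root or edge.\<close>

definition spanning_word :: "nat \<Rightarrow> int \<Rightarrow> int \<Rightarrow> bool" where
  "spanning_word n c e \<longleftrightarrow> (\<exists>w. length w = 2 * n + 1 \<and>
     fst (fold move w (0, 1)) mod (2 * int n + 1) = c mod (2 * int n + 1) \<and>
     snd (fold move w (0, 1)) = e \<and> (\<forall>z. covers (2 * int n + 1) w (0, 1) z))"

lemma spanning_wordI:
  assumes "length w = 2 * n + 1" "fold move w (0, 1) = (c + t * (2 * int n + 1), e)"
    and "\<And>z. covers (2 * int n + 1) w (0, 1) z"
  shows "spanning_word n c e"
  using assms by (auto simp: spanning_word_def intro!: exI[of _ w])

text \<open>The endpoints of the four families below are, for \<open>0 \<le> t \<le> n\<close>, \<open>(\<plusminus> 2 * t, 1)\<close> and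
  \<open>(- 1 \<plusminus> 2 * t, - 1)\<close> modulo \<open>2 * n + 1\<close>. Since this modulus is odd, they exhaust the dihedral group.\<close>

lemma spanning_word_A:
  assumes sp: "2 * s + p \<le> n" "p \<le> 1"
  shows "spanning_word n (- 4 * int s - 3 * int p) (1 - 2 * int p)"
proof (rule spanning_wordI)
  define k where "k = 2 * int n + 1"
  \<comment> \<open>The first run covers the even coordinates below \<open>2 * (n - 2 * s)\<close>,
    and the blocks cover everything from there up to \<open>2 * n - 1\<close>. The second run starts
    at \<open>2 * n\<close> and wraps around onto the odd coordinates 1, 3, and so on. If
    \<open>p = 1\<close>, it stops one short, and the final \<open>Flip\<close> joins the missing
    odd coordinate to its even successor.\<close>
  let ?w = "replicate (n - 2 * s) Rot @ blocks s @ replicate (n + 1 - 2 * s - p) Rot @ replicate p Flip"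
  obtain m where n: "n = 2 * s + p + m" using le_Suc_ex[OF sp(1)] by blast
  have p: "p = 0 \<or> p = 1" using sp by auto
  show "length ?w = 2 * n + 1"
    using n by (simp add: length_blocks)
  show "fold move ?w (0, 1) = (- 4 * int s - 3 * int p + 2 * (2 * int n + 1), 1 - 2 * int p)"
    using p n by (auto simp: funpow_move_Rot fold_move_blocks)
  let ?C = "covers k ?w (0, 1)"
  have R1: "?C (2 * int i)" if "i < n - 2 * s" for i
    using covers_replicate_Rot[OF that, of k 0 1] by (intro covers_appendI1) simp
  have Bk: "?C (2 * int (n - 2 * s) + int j)" if "j < 4 * s" for j
    using covers_blocks[OF that, of k "2 * int (n - 2 * s)" 1]
    by (intro covers_mid) (simp add: funpow_move_Rot)
  have R2: "?C (2 * int n + 2 * int i)" if "i < n + 1 - 2 * s - p" for i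
    using covers_replicate_Rot[OF that, of k "2 * int n" 1] n
    by (intro covers_mid2) (simp add: funpow_move_Rot fold_move_blocks algebra_simps)
  have even: "?C (2 * int i)" if i: "i \<le> n" for i
  proof -
    consider "i < n - 2 * s" | "n - 2 * s \<le> i" "i < n" | "i = n" using i by linarith
    then show ?thesis
    proof cases
      case 2
      then have eq: "2 * int (n - 2 * s) + int (2 * i - 2 * (n - 2 * s)) = 2 * int i"
        and less: "2 * i - 2 * (n - 2 * s) < 4 * s"
        by linarith+
      from Bk[OF less] show ?thesis by (simp only: eq)
    next
      case 3
      then show ?thesis using R2[of 0] n by simp
    qed (rule R1)
  qed
  have odd: "?C (2 * int i + 1)" if i: "i < n" for i
  proof -
    consider "n - 2 * s \<le> i" | "i < n - 2 * s - p" | "p = 1" "i = n - 2 * s - 1"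
      using i p by linarith
    then show ?thesis
    proof cases
      case 1
      then have eq: "2 * int (n - 2 * s) + int (2 * i + 1 - 2 * (n - 2 * s)) = 2 * int i + 1"
        and less: "2 * i + 1 - 2 * (n - 2 * s) < 4 * s"
        using i by linarith+
      from Bk[OF less] show ?thesis by (simp only: eq)
    next
      case 2
      then show ?thesis
        using R2[of "Suc i"] by - (rule covers_shift[of _ _ _ "2 * int n + 2 * int (Suc i)" _ "- 1"], auto simp: k_def)
    next
      case 3
      let ?c = "2 * int i + 1 + k"
      have "fold move (replicate (n - 2 * s) Rot @ blocks s @ replicate (n + 1 - 2 * s - p) Rot) (0, 1) = (?c, 1)"
        using 3 n by (simp add: funpow_move_Rot fold_move_blocks k_def)
      from covers_Flip_iff[OF this, of k "[]"] 3 have "?C (?c + 1) \<longleftrightarrow> ?C ?c"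
        by simp
      moreover have "?C (?c + 1)"
        using even[of "Suc i"] that
        by - (rule covers_shift[of _ _ _ "2 * int (Suc i)" _ 1], auto)
      ultimately show ?thesis
        by - (rule covers_shift[of _ _ _ ?c _ "- 1"], auto)
    qed
  qed
  show "covers (2 * int n + 1) ?w (0, 1) z" for z
    using covers_allI[OF k_def even odd] by (simp add: k_def)
qed


text \<open>The initial \<open>Flip\<close> joins 0 to 1 and reverses the direction. Modulo
  \<open>k\<close>, the first run then descends through the even coordinates from
  \<open>2 * n\<close> to \<open>4 * s + 4\<close>, the blocks fill the interval from
  \<open>4 * s + 2\<close> down to 3, and the second run takes 2, 0 and then the odd coordinates
  from \<open>2 * n - 1\<close> downwards. If \<open>p = 1\<close>, the last \<open>Flip\<close>
  joins the missing \<open>4 * s + 3\<close> to \<open>4 * s + 2\<close>.\<close>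

lemma spanning_word_B:
  assumes sp: "2 * s + p + 1 \<le> n" "p \<le> 1"
  shows "spanning_word n (4 * int s + 1 + 3 * int p) (2 * int p - 1)"
proof (rule spanning_wordI)
  define k where "k = 2 * int n + 1"
  let ?w = "[] @ Flip # replicate (n - 1 - 2 * s) Rot @ blocks s @ replicate (n + 1 - 2 * s - p) Rot @ replicate p Flip"
  obtain m where n: "n = 2 * s + p + 1 + m" using le_Suc_ex[OF sp(1)] by blast
  have p: "p = 0 \<or> p = 1" using sp by auto
  show "length ?w = 2 * n + 1"
    using n by (simp add: length_blocks)
  show "fold move ?w (0, 1) = (4 * int s + 1 + 3 * int p + (- 2) * (2 * int n + 1), 2 * int p - 1)"
    using p n by (auto simp: funpow_move_Rot fold_move_blocks)
  let ?C = "covers k ?w (0, 1)"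
  have tail: "?C z" if "covers k (replicate (n - 1 - 2 * s) Rot @ blocks s @ replicate (n + 1 - 2 * s - p) Rot @ replicate p Flip) (- 1, - 1) z" for z
    using covers_appendI2[of k _ "[Flip]" "(0, 1)"] that by simp
  have R1: "?C (- 1 - 2 * int i)" if "i < n - 1 - 2 * s" for i
    using covers_replicate_Rot[OF that, of k "- 1" "- 1"] by (intro tail covers_appendI1) simp
  have Bk: "?C (1 + 4 * int s - 2 * int n - int j)" if "j < 4 * s" for j
    using covers_blocks[OF that, of k "1 + 4 * int s - 2 * int n" "- 1"] n
    by (intro tail covers_mid) (simp add: funpow_move_Rot)
  have R2: "?C (1 - 2 * int n - 2 * int i)" if "i < n + 1 - 2 * s - p" for i
    using covers_replicate_Rot[OF that, of k "1 - 2 * int n" "- 1"] n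
    by (intro tail covers_mid2) (simp add: funpow_move_Rot fold_move_blocks algebra_simps)
  have even: "?C (2 * int i)" if i: "i \<le> n" for i
  proof -
    consider "i = 0" | "i = 1" | "2 \<le> i" "i \<le> 2 * s + 1" | "2 * s + 2 \<le> i" by linarith
    then show ?thesis
    proof cases
      case 1
      then show ?thesis
        using R2[of 1] sp by - (rule covers_shift[of _ _ _ "1 - 2 * int n - 2 * int 1" _ 1], auto simp: k_def)
    next
      case 2
      then show ?thesis
        using R2[of 0] sp by - (rule covers_shift[of _ _ _ "1 - 2 * int n - 2 * int 0" _ 1], auto simp: k_def)
    next
      case 3
      then have "int (4 * s + 2 - 2 * i) = 4 * int s + 2 - 2 * int i" "4 * s + 2 - 2 * i < 4 * s"
        by linarith+
      then show ?thesis
        using Bk[of "4 * s + 2 - 2 * i"]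
        by - (rule covers_shift[of _ _ _ "1 + 4 * int s - 2 * int n - int (4 * s + 2 - 2 * i)" _ 1], auto simp: k_def)
    next
      case 4
      then have "int (n - i) = int n - int i" "n - i < n - 1 - 2 * s"
        using that sp by linarith+
      then show ?thesis
        using R1[of "n - i"]
        by - (rule covers_shift[of _ _ _ "- 1 - 2 * int (n - i)" _ 1], auto simp: k_def)
    qed
  qed
  have odd: "?C (2 * int i + 1)" if i: "i < n" for i
  proof -
    consider "i = 0" | "1 \<le> i" "i \<le> 2 * s" | "2 * s + 1 + p \<le> i" | "p = 1" "i = 2 * s + 1"
      using p by linarith
    then show ?thesis
    proof cases
      case 1
      have "?C (0 + 1) \<longleftrightarrow> ?C 0"
        by (rule covers_Flip_iff) simp
      with even[of 0] 1 show ?thesis by simp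
    next
      case 2
      then have "int (4 * s + 1 - 2 * i) = 4 * int s + 1 - 2 * int i" "4 * s + 1 - 2 * i < 4 * s"
        by linarith+
      then show ?thesis
        using Bk[of "4 * s + 1 - 2 * i"]
        by - (rule covers_shift[of _ _ _ "1 + 4 * int s - 2 * int n - int (4 * s + 1 - 2 * i)" _ 1], auto simp: k_def)
    next
      case 3
      then have "int (n + 1 - i) = int n + 1 - int i" "n + 1 - i < n + 1 - 2 * s - p"
        using that sp by linarith+
      then show ?thesis
        using R2[of "n + 1 - i"]
        by - (rule covers_shift[of _ _ _ "1 - 2 * int n - 2 * int (n + 1 - i)" _ 2], auto simp: k_def)
    next
      case 4
      let ?c = "4 * int s + 3 - 2 * k"
      have "fold move ([] @ Flip # replicate (n - 1 - 2 * s) Rot @ blocks s @ replicate (n + 1 - 2 * s - p) Rot) (0, 1) = (?c, - 1)"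
        using 4 n by (simp add: funpow_move_Rot fold_move_blocks k_def)
      from covers_Flip_iff[OF this, of k "[]"] 4 have "?C (?c + - 1) \<longleftrightarrow> ?C ?c"
        by simp
      moreover have "?C (?c + - 1)"
        using even[of "2 * s + 1"] sp
        by - (rule covers_shift[of _ _ _ "2 * int (2 * s + 1)" _ "- 2"], auto)
      ultimately show ?thesis
        using 4 by - (rule covers_shift[of _ _ _ ?c _ 2], auto)
    qed
  qed
  show "covers (2 * int n + 1) ?w (0, 1) z" for z
    using covers_allI[OF k_def even odd] by (simp add: k_def)
qed

text \<open>The blocks fill the interval from 0 to \<open>4 * s - 1\<close>, and the first run takes
  the even coordinates up to \<open>2 * n - 2\<close>. The middle \<open>Flip\<close> joins
  \<open>2 * n\<close> to \<open>2 * n + 1\<close>, which is 0 modulo \<open>k\<close>, and turns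
  back, so that the second run descends through the odd coordinates. If \<open>p = 1\<close>, the
  last \<open>Flip\<close> joins the missing \<open>4 * s + 1\<close> to
  \<open>4 * s\<close>.\<close>

lemma spanning_word_C:
  assumes sp: "2 * s + p \<le> n" "p \<le> 1" "0 < n"
  shows "spanning_word n (4 * int s - 1 + 3 * int p) (2 * int p - 1)"
proof (rule spanning_wordI)
  define k where "k = 2 * int n + 1"
  let ?w = "(blocks s @ replicate (n - 2 * s) Rot) @ Flip # replicate (n - 2 * s - p) Rot @ replicate p Flip"
  obtain m where n: "n = 2 * s + p + m" using le_Suc_ex[OF sp(1)] by blast
  have p: "p = 0 \<or> p = 1" using sp by auto
  show "length ?w = 2 * n + 1"
    using n by (simp add: length_blocks)
  show "fold move ?w (0, 1) = (4 * int s - 1 + 3 * int p + 0 * (2 * int n + 1), 2 * int p - 1)"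
    using p n by (auto simp: funpow_move_Rot fold_move_blocks)
  let ?C = "covers k ?w (0, 1)"
  have Bk: "?C (int j)" if "j < 4 * s" for j
    using covers_blocks[OF that, of k 0 1]
    by (intro covers_appendI1) simp
  have R1: "?C (4 * int s + 2 * int i)" if "i < n - 2 * s" for i
    using covers_replicate_Rot[OF that, of k "4 * int s" "1"]
    by (intro covers_appendI1[of _ _ _ _ "Flip # _"] covers_appendI2) (simp add: fold_move_blocks)
  have R2: "?C (2 * int n - 1 - 2 * int i)" if "i < n - 2 * s - p" for i
  proof -
    have "covers k (((blocks s @ replicate (n - 2 * s) Rot) @ [Flip]) @ replicate (n - 2 * s - p) Rot @ replicate p Flip) (0, 1) (2 * int n - 1 - 2 * int i)"
      using covers_replicate_Rot[OF that, of k "2 * int n - 1" "- 1"] n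
      by (intro covers_mid) (simp add: funpow_move_Rot fold_move_blocks algebra_simps)
    then show ?thesis by simp
  qed
  have even': "?C (2 * int i)" if "i < n" for i
  proof (cases "i < 2 * s")
    case True
    then show ?thesis using Bk[of "2 * i"] by simp
  next
    case False
    then have "int (i - 2 * s) = int i - 2 * int s" "i - 2 * s < n - 2 * s"
      using that by linarith+
    then show ?thesis using R1[of "i - 2 * s"] by simp
  qed
  have "?C (2 * int n + 1) \<longleftrightarrow> ?C (2 * int n)"
    by (rule covers_Flip_iff) (use n in \<open>simp add: funpow_move_Rot fold_move_blocks\<close>)
  moreover have "?C (2 * int n + 1)"
    using even'[of 0] sp by - (rule covers_shift[of _ _ _ 0 _ 1], auto simp: k_def)
  ultimately have even: "?C (2 * int i)" if "i \<le> n" for i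
    using even'[of i] that by (cases "i = n") auto
  have odd: "?C (2 * int i + 1)" if i: "i < n" for i
  proof -
    consider "i < 2 * s" | "2 * s + p \<le> i" | "p = 1" "i = 2 * s"
      using p by linarith
    then show ?thesis
    proof cases
      case 1
      then show ?thesis using Bk[of "2 * i + 1"] by (simp add: add.commute)
    next
      case 2
      then have "int (n - 1 - i) = int n - 1 - int i" "n - 1 - i < n - 2 * s - p"
        using that by linarith+
      then show ?thesis using R2[of "n - 1 - i"] by (simp add: add.commute)
    next
      case 3
      let ?c = "4 * int s + 1"
      have "fold move ((blocks s @ replicate (n - 2 * s) Rot) @ Flip # replicate (n - 2 * s - p) Rot) (0, 1) = (?c, - 1)"
        using 3 n by (simp add: funpow_move_Rot fold_move_blocks)
      from covers_Flip_iff[OF this, of k "[]"] 3 have "?C (?c + - 1) \<longleftrightarrow> ?C ?c"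
        by simp
      with even[of "2 * s"] sp 3 show ?thesis by simp
    qed
  qed
  show "covers (2 * int n + 1) ?w (0, 1) z" for z
    using covers_allI[OF k_def even odd] by (simp add: k_def)
qed

text \<open>The run of \<open>f\<close> rotations takes the even coordinates below
  \<open>2 * f\<close>, the \<open>Flip\<close> joins \<open>2 * f\<close> to
  \<open>2 * f + 1\<close>, and the second run returns through the odd coordinates below
  \<open>2 * f\<close>. It ends at -1, which is \<open>2 * n\<close> modulo \<open>k\<close>, and
  the blocks descend from there. If \<open>p = 1\<close>, the closing \<open>Rot\<close> covers
  \<open>2 * f + 2\<close> and the closing \<open>Flip\<close> joins \<open>2 * f\<close> to
  \<open>2 * f - 1\<close>.\<close>

lemma spanning_word_D:
  assumes sp: "2 * s + p \<le> n" "p \<le> 1" "0 < n"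
  shows "spanning_word n (- 4 * int s - 1 - int p) (2 * int p - 1)"
proof (rule spanning_wordI)
  define k where "k = 2 * int n + 1"
  define f where "f = n - 2 * s - p"
  let ?u = "replicate f Rot @ Flip # replicate f Rot @ blocks s"
  let ?w = "replicate f Rot @ Flip # replicate f Rot @ blocks s @ concat (replicate p [Rot, Flip])"
  from sp have n: "n = 2 * s + p + f" by (simp add: f_def)
  have p: "p = 0 \<or> p = 1" using sp by auto
  show "length ?w = 2 * n + 1"
    using n p by (auto simp: length_blocks)
  show "fold move ?w (0, 1) = (- 4 * int s - 1 - int p + 0 * (2 * int n + 1), 2 * int p - 1)"
    using p n by (auto simp: funpow_move_Rot fold_move_blocks)
  let ?C = "covers k ?w (0, 1)"
  have tail: "?C z" if "covers k (replicate f Rot @ blocks s @ concat (replicate p [Rot, Flip])) (2 * int f - 1, - 1) z" for z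
    using covers_appendI2[of k _ "replicate f Rot @ [Flip]" "(0, 1)"] that by (simp add: funpow_move_Rot)
  have R1: "?C (2 * int i)" if "i < f" for i
    using covers_replicate_Rot[OF that, of k 0 1] by (intro covers_appendI1) simp
  have R2: "?C (2 * int f - 1 - 2 * int i)" if "i < f" for i
    using covers_replicate_Rot[OF that, of k "2 * int f - 1" "- 1"]
    by (intro tail covers_appendI1) simp
  have Bk: "?C (2 * int n - int j)" if "j < 4 * s" for j
  proof -
    have "?C (- 1 - int j)"
      using covers_blocks[OF that, of k "- 1" "- 1"]
      by (intro tail covers_mid) (simp add: funpow_move_Rot)
    then show ?thesis
      by (rule covers_shift[of _ _ _ _ _ 1]) (simp add: k_def)
  qed
  have Rot: "?C (2 * int n - 4 * int s)" if "p = 1"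
  proof -
    have "?C (- 1 - 4 * int s)"
      using covers_Rot[of k "[Flip]" "- 1 - 4 * int s" "- 1"] that
      by (intro tail covers_appendI2) (simp add: funpow_move_Rot fold_move_blocks)
    then show ?thesis
      by (rule covers_shift[of _ _ _ _ _ 1]) (simp add: k_def)
  qed
  have edge: "?C (2 * int f + 1) \<longleftrightarrow> ?C (2 * int f)"
    by (rule covers_Flip_iff) (simp add: funpow_move_Rot)
  \<comment> \<open>For \<open>p = 0\<close> the other end \<open>2 * f + 1\<close> of the first
    edge is covered by the last block or, if \<open>s = 0\<close>, is the coordinate 0 modulo
    \<open>k\<close>. For \<open>p = 1\<close> the closing edge is used instead; if
    \<open>f = 0\<close>, its other end is \<open>2 * n\<close> modulo \<open>k\<close>.\<close>
  have joint: "?C (2 * int f)"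
  proof (cases "p = 0")
    case True
    have "?C (2 * int f + 1)"
    proof (cases "s = 0")
      case False
      then show ?thesis using Bk[of "4 * s - 1"] n True by (simp add: of_nat_diff)
    next
      case s: True
      then show ?thesis
        using R1[of 0] n True sp by - (rule covers_shift[of _ _ _ 0 _ 1], auto simp: k_def)
    qed
    with edge show ?thesis by simp
  next
    case False
    with p have p1: "p = 1" by simp
    let ?c = "2 * int f - k"
    have "fold move (?u @ [Rot]) (0, 1) = (?c, - 1)"
      using n p1 by (simp add: funpow_move_Rot fold_move_blocks k_def)
    from covers_Flip_iff[OF this, of k "[]"] p1 have "?C (?c + - 1) \<longleftrightarrow> ?C ?c"
      by simp
    moreover have "?C (?c + - 1)"
    proof (cases "f = 0")
      case False
      then show ?thesis
        using R2[of 0] by - (rule covers_shift[of _ _ _ "2 * int f - 1" _ "- 1"], auto)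
    next
      case True
      have "?C (2 * int n)"
        using Bk[of 0] Rot[OF p1] by (cases "s = 0") auto
      then show ?thesis
        using True by - (rule covers_shift[of _ _ _ "2 * int n" _ "- 2"], auto simp: k_def)
    qed
    ultimately show ?thesis
      by - (rule covers_shift[of _ _ _ ?c _ 1], auto)
  qed
  have even: "?C (2 * int i)" if i: "i \<le> n" for i
  proof -
    consider "i < f" | "i = f" | "n - 2 * s < i" | "p = 1" "i = n - 2 * s"
      using p n by linarith
    then show ?thesis
    proof cases
      case 3
      then have "int (2 * (n - i)) = 2 * int n - 2 * int i" "2 * (n - i) < 4 * s"
        using that by linarith+
      then show ?thesis using Bk[of "2 * (n - i)"] by simp
    next
      case 4
      then show ?thesis using Rot n by (simp add: of_nat_diff)
    qed (use R1 joint in auto)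
  qed
  have odd: "?C (2 * int i + 1)" if i: "i < n" for i
  proof -
    consider "i < f" | "i = f" | "n - 2 * s \<le> i"
      using p n by linarith
    then show ?thesis
    proof cases
      case 1
      then have "int (f - 1 - i) = int f - 1 - int i" "f - 1 - i < f"
        by linarith+
      then show ?thesis using R2[of "f - 1 - i"] by (simp add: add.commute)
    next
      case 2
      with joint edge show ?thesis by simp
    next
      case 3
      then have "int (2 * (n - i) - 1) = 2 * int n - 2 * int i - 1" "2 * (n - i) - 1 < 4 * s"
        using that by linarith+
      then show ?thesis using Bk[of "2 * (n - i) - 1"] by simp
    qed
  qed
  show "covers (2 * int n + 1) ?w (0, 1) z" for z
    using covers_allI[OF k_def even odd] by (simp add: k_def)
qed

section \<open>Spanning words for all dihedral elements\<close>

lemma spanning_word_cong: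
  assumes "spanning_word n c e" "c mod (2 * int n + 1) = c' mod (2 * int n + 1)"
  shows "spanning_word n c' e"
  using assms by (simp add: spanning_word_def)

lemma spanning_word_exists:
  assumes n: "0 < n" and e: "e = 1 \<or> e = - 1"
  shows "spanning_word n c e"
proof -
  define k where "k = 2 * int n + 1"
  \<comment> \<open>The families reach rotations at even offsets from 0 and reflections at even
    offsets from -1.\<close>
  define b where "b = (if e = 1 then 0 else - 1 :: int)"
  define r where "r = nat ((c - b) mod k)"
  have r: "int r = (c - b) mod k" "r < 2 * n + 1"
    unfolding r_def using k_def pos_mod_bound[of k "c - b"] pos_mod_sign[of k "c - b"] by linarith+
  have target: "spanning_word n c e" if "spanning_word n (b + int r + t * k) e" for t
  proof (rule spanning_word_cong[OF that])
    have "(b + int r + t * k) mod k = c mod k"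
      by (simp add: r mod_simps)
    then show "(b + int r + t * k) mod (2 * int n + 1) = c mod (2 * int n + 1)"
      by (simp add: k_def)
  qed
  \<comment> \<open>The modulus is odd, so \<open>r\<close> or its complement is even. The residue
    of that even number modulo 4 and the sign \<open>e\<close> then select the family and
    \<open>p\<close>.\<close>
  consider s where "r = 4 * s" | s where "r = 4 * s + 2"
    | s where "2 * n + 1 - r = 4 * s" | s where "2 * n + 1 - r = 4 * s + 2"
  proof -
    have "(\<exists>s. r = 4 * s) \<or> (\<exists>s. r = 4 * s + 2) \<or> (\<exists>s. 2 * n + 1 - r = 4 * s) \<or> (\<exists>s. 2 * n + 1 - r = 4 * s + 2)"
      using r(2) by presburger
    then show ?thesis using that by blast
  qed
  then show ?thesis
  proof cases
    case (1 s)
    show ?thesis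
    proof (cases "e = 1")
      case True
      show ?thesis
      \<comment> \<open>The rotations reached by family B start at 4, so the identity comes from
        family A, as the word of \<open>k\<close> rotations.\<close>
      proof (cases s)
        case 0
        with spanning_word_A[of 0 0 n] 1 True target[of 0] show ?thesis by (simp add: b_def)
      next
        case (Suc s')
        with spanning_word_B[of s' 1 n] 1 True target[of 0] r(2) show ?thesis by (simp add: b_def)
      qed
    next
      case False
      with spanning_word_C[of s 0 n] 1 e target[of 0] r(2) n show ?thesis by (simp add: b_def)
    qed
  next
    case (2 s)
    show ?thesis
    proof (cases "e = 1")
      case True
      with spanning_word_C[of s 1 n] 2 target[of 0] r(2) n show ?thesis by (simp add: b_def)
    next
      case False
      with spanning_word_B[of s 0 n] 2 e target[of 0] r(2) show ?thesis
        by (simp add: b_def add.commute)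
    qed
  next
    case (3 s)
    then have s: "int r = k - 4 * int s" "2 * s \<le> n"
      using r(2) unfolding k_def by linarith+
    show ?thesis
    proof (rule target[of "- 1"], cases "e = 1")
      case True
      then have "b + int r + - 1 * k = - 4 * int s - 3 * int 0"
        by (simp add: b_def s)
      moreover have "spanning_word n (- 4 * int s - 3 * int 0) e"
        using spanning_word_A[of s 0 n] s True by simp
      ultimately show "spanning_word n (b + int r + - 1 * k) e"
        by (simp only:)
    next
      case False
      then have "b + int r + - 1 * k = - 4 * int s - 1 - int 0"
        by (simp add: b_def s)
      moreover have "spanning_word n (- 4 * int s - 1 - int 0) e"
        using spanning_word_D[of s 0 n] s n e False by simp
      ultimately show "spanning_word n (b + int r + - 1 * k) e"
        by (simp only:)
    qed
  next
    case (4 s)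
    then have s: "int r = k - 4 * int s - 2" "2 * s + 1 \<le> n"
      using r(2) unfolding k_def by linarith+
    show ?thesis
    proof (rule target[of "- 1"], cases "e = 1")
      case True
      then have "b + int r + - 1 * k = - 4 * int s - 1 - int 1"
        by (simp add: b_def s)
      moreover have "spanning_word n (- 4 * int s - 1 - int 1) e"
        using spanning_word_D[of s 1 n] s n True by simp
      ultimately show "spanning_word n (b + int r + - 1 * k) e"
        by (simp only:)
    next
      case False
      then have "b + int r + - 1 * k = - 4 * int s - 3 * int 1"
        by (simp add: b_def s)
      moreover have "spanning_word n (- 4 * int s - 3 * int 1) e"
        using spanning_word_A[of s 1 n] s e False by simp
      ultimately show "spanning_word n (b + int r + - 1 * k) e"
        by (simp only:)
    qed
  qed
qed

section \<open>The semidirect product\<close>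

text \<open>Extensional functions and reduced residues give every group element a single
  representative. The argument \<open>e * (y - c)\<close> applies the inverse of the dihedral map,
  since \<open>e\<close> is its own inverse.\<close>

definition wreath :: "int \<Rightarrow> int \<Rightarrow> ((int \<Rightarrow> int) \<times> int \<times> int) monoid" where
  "wreath m k =
     \<lparr> carrier = ({0..<k} \<rightarrow>\<^sub>E {0..<m}) \<times> {0..<k} \<times> {1, - 1},
       mult = (\<lambda>(h, c, e) (h', c', e').
         (\<lambda>y\<in>{0..<k}. (h y + h' (e * (y - c) mod k)) mod m, (c + e * c') mod k, e * e')),
       one = (\<lambda>y\<in>{0..<k}. 0, 0, 1) \<rparr>"

definition wreath_elem :: "int \<Rightarrow> int \<Rightarrow> (int \<Rightarrow> int) \<Rightarrow> int \<times> int \<Rightarrow> (int \<Rightarrow> int) \<times> int \<times> int" where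
  "wreath_elem m k f q = (\<lambda>y\<in>{0..<k}. f y mod m, fst q mod k, snd q)"

definition wreath_gen :: "int \<Rightarrow> int \<Rightarrow> letter \<Rightarrow> int \<Rightarrow> (int \<Rightarrow> int) \<times> int \<times> int" where
  "wreath_gen m k l x = wreath_elem m k (\<lambda>y. x * item k l (0, 1) y) (move l (0, 1))"

definition wreath_gens :: "int \<Rightarrow> int \<Rightarrow> ((int \<Rightarrow> int) \<times> int \<times> int) set" where
  "wreath_gens m k = wreath_gen m k Rot ` {0..<m} \<union> wreath_gen m k Flip ` {0..<m}"

lemma carrier_wreath_iff:
  "(h, c, e) \<in> carrier (wreath m k) \<longleftrightarrow>
     h \<in> {0..<k} \<rightarrow>\<^sub>E {0..<m} \<and> c \<in> {0..<k} \<and> (e = 1 \<or> e = - 1)"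
  by (auto simp: wreath_def)

lemma mult_wreath:
  "(h, c, e) \<otimes>\<^bsub>wreath m k\<^esub> (h', c', e') =
     (\<lambda>y\<in>{0..<k}. (h y + h' (e * (y - c) mod k)) mod m, (c + e * c') mod k, e * e')"
  by (simp add: wreath_def)

lemma one_wreath: "\<one>\<^bsub>wreath m k\<^esub> = (\<lambda>y\<in>{0..<k}. 0, 0, 1)"
  by (simp add: wreath_def)

lemma group_wreath:
  assumes "0 < m" "0 < k"
  shows "group (wreath m k)"
proof (rule groupI)
  show "\<one>\<^bsub>wreath m k\<^esub> \<in> carrier (wreath m k)"
    using assms by (auto simp: wreath_def)
next
  fix x y assume "x \<in> carrier (wreath m k)" "y \<in> carrier (wreath m k)"
  then show "x \<otimes>\<^bsub>wreath m k\<^esub> y \<in> carrier (wreath m k)"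
    using assms by (cases x; cases y) (auto simp: carrier_wreath_iff mult_wreath)
next
  fix x y z
  assume xyz: "x \<in> carrier (wreath m k)" "y \<in> carrier (wreath m k)" "z \<in> carrier (wreath m k)"
  obtain h c e h' c' e' h'' c'' e'' where
    eqs: "x = (h, c, e)" "y = (h', c', e')" "z = (h'', c'', e'')"
    by (cases x; cases y; cases z)
  have e: "e = 1 \<or> e = - 1" "e' = 1 \<or> e' = - 1"
    using xyz by (auto simp: eqs carrier_wreath_iff)
  \<comment> \<open>Undoing the two dihedral maps one after the other is undoing their product,
    which makes the vector parts associate.\<close>
  have *: "e' * (e * (t - c) mod k - c') mod k = e * e' * (t - (c + e * c') mod k) mod k" for t
  proof -
    have "e' * (e * (t - c) mod k - c') mod k = e' * (e * (t - c) - c') mod k"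
      by (intro mod_mult_cong mod_diff_cong) simp_all
    also have "e' * (e * (t - c) - c') = e * e' * (t - (c + e * c'))"
      using e by (auto simp: algebra_simps)
    also have "\<dots> mod k = e * e' * (t - (c + e * c') mod k) mod k"
      by (intro mod_mult_cong mod_diff_cong) simp_all
    finally show ?thesis .
  qed
  show "x \<otimes>\<^bsub>wreath m k\<^esub> y \<otimes>\<^bsub>wreath m k\<^esub> z = x \<otimes>\<^bsub>wreath m k\<^esub> (y \<otimes>\<^bsub>wreath m k\<^esub> z)"
  proof -
    have "((c + e * c') mod k + e * e' * c'') mod k = (c + e * (c' + e' * c'')) mod k"
      by (simp add: mod_simps algebra_simps)
    also have "\<dots> = (c + e * ((c' + e' * c'') mod k)) mod k"
      by (intro mod_add_cong mod_mult_cong) simp_all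
    finally show ?thesis
      using assms(2) by (simp add: eqs mult_wreath * mod_add_left_eq mod_add_right_eq add.assoc mult.assoc cong: restrict_cong)
  qed
next
  fix x assume "x \<in> carrier (wreath m k)"
  then show "\<one>\<^bsub>wreath m k\<^esub> \<otimes>\<^bsub>wreath m k\<^esub> x = x"
    by (cases x) (auto simp: carrier_wreath_iff mult_wreath one_wreath fun_eq_iff PiE_def Pi_def extensional_def)
next
  fix x assume x: "x \<in> carrier (wreath m k)"
  obtain h c e where eqs: "x = (h, c, e)" by (cases x)
  \<comment> \<open>The inverse of the dihedral part \<open>(c, e)\<close> is
    \<open>(- e * c, e)\<close>, and the vector is negated after being carried along by it.\<close>
  define y where "y = (\<lambda>t\<in>{0..<k}. (- h ((e * t + c) mod k)) mod m, (- e * c) mod k, e)"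
  have e: "e = 1 \<or> e = - 1"
    using x by (auto simp: eqs carrier_wreath_iff)
  have "e * (t - - e * c mod k) mod k = (e * t + c) mod k" for t
  proof -
    have "e * (t - - e * c mod k) mod k = e * (t - - e * c) mod k"
      by (intro mod_mult_cong mod_diff_cong) simp_all
    also have "e * (t - - e * c) = e * t + c"
      using e by auto
    finally show ?thesis .
  qed
  then have "y \<otimes>\<^bsub>wreath m k\<^esub> x = \<one>\<^bsub>wreath m k\<^esub>"
    using e by (auto simp: y_def eqs mult_wreath one_wreath mod_simps fun_eq_iff)
  moreover have "y \<in> carrier (wreath m k)"
    using e assms by (auto simp: y_def carrier_wreath_iff)
  ultimately show "\<exists>y\<in>carrier (wreath m k). y \<otimes>\<^bsub>wreath m k\<^esub> x = \<one>\<^bsub>wreath m k\<^esub>"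
    by blast
qed

lemma finite_wreath: "finite (carrier (wreath m k))"
  by (auto simp: wreath_def intro!: finite_PiE)

lemma order_wreath:
  assumes "0 < m" "0 < k"
  shows "order (wreath m k) = 2 * nat k * nat m ^ nat k"
  using assms by (simp add: order_def wreath_def card_cartesian_product card_PiE)

section \<open>Products of generators spelling a word\<close>

lemma dvd_unit_shift:
  fixes k :: int
  assumes "e = 1 \<or> e = - 1"
  shows "k dvd e * (y - c) mod k - z \<longleftrightarrow> k dvd y - (c + e * z)"
proof -
  have unit: "k dvd e * t \<longleftrightarrow> k dvd t" for t
    using assms by auto
  have "k dvd e * (y - c) mod k - z \<longleftrightarrow> k dvd e * (y - c) - z"
    by (simp add: mod_eq_0_iff_dvd[symmetric] mod_simps)
  also have "\<dots> \<longleftrightarrow> k dvd e * (e * (y - c) - z)"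
    by (rule unit[symmetric])
  also have "e * (e * (y - c) - z) = y - (c + e * z)"
    using assms by (auto simp: algebra_simps)
  finally show ?thesis .
qed

text \<open>Acting on a generator's vector by the current dihedral element translates its root or
  edge to the current position. This is why \<open>item\<close> describes the contribution of a
  letter.\<close>

lemma item_shift:
  assumes "e = 1 \<or> e = - 1"
  shows "item k l (0, 1) (e * (y - c) mod k) = item k l (c, e) y"
  using assms dvd_unit_shift[OF assms, of k y c 0] dvd_unit_shift[OF assms, of k y c 1]
  by (cases l) (simp_all add: delta_def)

lemma elem_mult_gen:
  assumes "0 < k" "snd q = 1 \<or> snd q = - 1"
  shows "wreath_elem m k f q \<otimes>\<^bsub>wreath m k\<^esub> wreath_gen m k l x = wreath_elem m k (\<lambda>y. f y + x * item k l q y) (move l q)"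
proof -
  obtain c e where q: "q = (c, e)" by (cases q)
  have "e * (y - c mod k) mod k = e * (y - c) mod k" for y
    by (intro mod_mult_cong mod_diff_cong) simp_all
  then have item: "item k l (0, 1) (e * (y - c mod k) mod k) = item k l (c, e) y" for y
    using item_shift[of e k l y c] assms(2) by (simp only: q snd_conv)
  have "(c mod k + e * (fst (move l (0, 1)) mod k)) mod k = (c + e * fst (move l (0, 1))) mod k"
    by (intro mod_add_cong mod_mult_cong) simp_all
  also have "c + e * fst (move l (0, 1)) = fst (move l (c, e))"
    by (cases l) auto
  finally have pos: "(c mod k + e * (fst (move l (0, 1)) mod k)) mod k = fst (move l (c, e)) mod k" .
  have dir: "e * snd (move l (0, 1)) = snd (move l (c, e))"
    by (cases l) auto
  show ?thesis
    using assms(1)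
    by (simp add: wreath_elem_def wreath_gen_def q mult_wreath item pos dir mod_add_eq cong: restrict_cong
        del: item.simps move.simps)
qed

lemma gen_cong:
  assumes "x mod m = x' mod m"
  shows "wreath_gen m k l x = wreath_gen m k l x'"
  using mod_mult_cong[OF assms refl] by (auto simp: wreath_gen_def wreath_elem_def fun_eq_iff)

text \<open>Labels use arbitrary integer coefficients, and reduction modulo \<open>m\<close> turns
  each into an actual generator.\<close>

lemma gen_in_gens:
  assumes "0 < m"
  shows "wreath_gen m k l x \<in> wreath_gens m k"
proof -
  have "wreath_gen m k l x = wreath_gen m k l (x mod m)" by (rule gen_cong) simp
  then show ?thesis using assms by (cases l) (auto simp: wreath_gens_def)
qed

text \<open>The vector \<open>g\<close> accumulates the contributions of the letters already read,
  which makes the induction along the word go through.\<close>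

lemma labels_imp_product:
  assumes "0 < m" "0 < k" "f \<in> labels k w q" "snd q = 1 \<or> snd q = - 1"
  shows "\<exists>xs. length xs = length w \<and> set xs \<subseteq> wreath_gens m k \<and>
    foldl (\<otimes>\<^bsub>wreath m k\<^esub>) (wreath_elem m k g q) xs = wreath_elem m k (\<lambda>y. g y + f y) (fold move w q)"
  using assms(3,4)
proof (induction w arbitrary: f g q)
  case Nil
  then show ?case by simp
next
  case (Cons l w)
  obtain x f' where f: "f = (\<lambda>y. x * item k l q y + f' y)" "f' \<in> labels k w (move l q)"
    using Cons.prems(1) by (rule labels_ConsE)
  have "snd (move l q) = 1 \<or> snd (move l q) = - 1"
    using Cons.prems(2) by (cases l; cases q) auto
  from Cons.IH[OF f(2) this, of "\<lambda>y. g y + x * item k l q y"] obtain xs where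
    "length xs = length w" "set xs \<subseteq> wreath_gens m k"
    "foldl (\<otimes>\<^bsub>wreath m k\<^esub>) (wreath_elem m k (\<lambda>y. g y + x * item k l q y) (move l q)) xs =
       wreath_elem m k (\<lambda>y. g y + x * item k l q y + f' y) (fold move w (move l q))"
    by blast
  then show ?case
    using Cons.prems(2) assms(1,2)
    by (intro exI[of _ "wreath_gen m k l x # xs"]) (simp add: gen_in_gens elem_mult_gen f(1) add.assoc)
qed

lemma sum_in_labels:
  assumes "finite A" "\<And>z. z \<in> A \<Longrightarrow> covers k w q z"
  shows "(\<lambda>y. \<Sum>z\<in>A. h z * delta k z y) \<in> labels k w q"
  using assms
proof (induction A)
  case empty
  then show ?case by (simp add: zero_in_labels)
next
  case (insert a A)
  then have "(\<lambda>y. (\<Sum>z\<in>A. h z * delta k z y) + h a * delta k a y) \<in> labels k w q"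
    by (intro labels_add_mult) (auto simp: covers_def)
  with insert.hyps show ?case by (simp add: add.commute)
qed

lemma sum_delta:
  assumes "y \<in> {0..<k}"
  shows "(\<Sum>z\<in>{0..<k}. h z * delta k z y) = h y"
proof -
  have "h z * delta k z y = (if z = y then h z else 0)" if "z \<in> {0..<k}" for z
    using that assms zdvd_imp_le[of k "\<bar>y - z\<bar>"] by (auto simp: delta_def)
  then have "(\<Sum>z\<in>{0..<k}. h z * delta k z y) = (\<Sum>z\<in>{0..<k}. if z = y then h z else 0)"
    by (intro sum.cong) auto
  with assms show ?thesis by simp
qed

lemma word_products:
  assumes "0 < m" "0 < n" and v: "v \<in> carrier (wreath m (2 * int n + 1))"
  defines "k \<equiv> 2 * int n + 1"
  shows "\<exists>xs. length xs = 2 * n + 1 \<and> set xs \<subseteq> wreath_gens m k \<and> foldl (\<otimes>\<^bsub>wreath m k\<^esub>) \<one>\<^bsub>wreath m k\<^esub> xs = v"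
proof -
  obtain h c e where veq: "v = (h, c, e)" by (cases v)
  with v have h: "h \<in> {0..<k} \<rightarrow>\<^sub>E {0..<m}" and c: "c \<in> {0..<k}" and e: "e = 1 \<or> e = - 1"
    by (simp_all add: carrier_wreath_iff k_def)
  from spanning_word_exists[OF \<open>0 < n\<close> e, of c] obtain w where w: "length w = 2 * n + 1"
    "fst (fold move w (0, 1)) mod k = c mod k" "snd (fold move w (0, 1)) = e"
    "\<And>z. covers k w (0, 1) z"
    unfolding spanning_word_def k_def by blast
  \<comment> \<open>The target vector is expanded in the indicators of the coordinates, all of which
    are covered by \<open>w\<close>.\<close>
  define f where "f = (\<lambda>y. \<Sum>z\<in>{0..<k}. h z * delta k z y)"
  have "f \<in> labels k w (0, 1)"
    unfolding f_def using w(4) by (intro sum_in_labels) auto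
  from labels_imp_product[OF \<open>0 < m\<close> _ this, of "\<lambda>_. 0"] obtain xs where xs: "length xs = length w"
    "set xs \<subseteq> wreath_gens m k"
    "foldl (\<otimes>\<^bsub>wreath m k\<^esub>) (wreath_elem m k (\<lambda>_. 0) (0, 1)) xs = wreath_elem m k f (fold move w (0, 1))"
    by (auto simp: k_def)
  have "wreath_elem m k (\<lambda>_. 0) (0, 1) = \<one>\<^bsub>wreath m k\<^esub>"
    by (simp add: wreath_elem_def one_wreath)
  moreover have "wreath_elem m k f (fold move w (0, 1)) = v"
  proof -
    have "f y mod m = h y" if "y \<in> {0..<k}" for y
      using sum_delta[OF that, of h] PiE_mem[OF h that] by (simp add: f_def)
    then have "(\<lambda>y\<in>{0..<k}. f y mod m) = h"
      using h by (auto simp: fun_eq_iff PiE_def extensional_def)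
    with w c show ?thesis by (simp add: wreath_elem_def veq)
  qed
  ultimately show ?thesis using xs w(1) by auto
qed

section \<open>Counting the generators and assembling the digraph\<close>

lemma gen_in_carrier:
  assumes "0 < m" "0 < k"
  shows "wreath_gen m k l x \<in> carrier (wreath m k)"
  using assms by (cases l) (auto simp: wreath_gen_def wreath_elem_def carrier_wreath_iff)

text \<open>The parameter can be read off at coordinate 0, where both kinds of item have value 1.
  For \<open>Flip\<close> this uses that 0 and 1 are distinct modulo \<open>k\<close>.\<close>

lemma inj_on_gen:
  assumes "1 < k"
  shows "inj_on (wreath_gen m k l) {0..<m}"
proof (rule inj_onI)
  fix x x' assume x: "x \<in> {0..<m}" "x' \<in> {0..<m}" "wreath_gen m k l x = wreath_gen m k l x'"
  have "item k l (0, 1) 0 = 1"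
    using assms by (cases l) (auto simp: delta_def)
  moreover have "fst (wreath_gen m k l x) 0 = fst (wreath_gen m k l x') 0"
    using x(3) by simp
  ultimately show "x = x'"
    using x assms by (simp add: wreath_gen_def wreath_elem_def)
qed

lemma card_gens:
  assumes "1 < k"
  shows "card (wreath_gens m k) = 2 * nat m"
proof -
  have "wreath_gen m k Rot ` {0..<m} \<inter> wreath_gen m k Flip ` {0..<m} = {}"
    by (auto simp: wreath_gen_def wreath_elem_def)
  then show ?thesis
    using inj_on_gen[OF assms] by (simp add: wreath_gens_def card_Un_disjoint card_image)
qed

text \<open>Even for parameter 0 the dihedral part is nontrivial: a \<open>Rot\<close> generator
  shifts by 2, which is nonzero modulo \<open>k\<close>, and a \<open>Flip\<close> generator has
  sign -1.\<close>

lemma one_notin_gens: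
  assumes "2 < k"
  shows "\<one>\<^bsub>wreath m k\<^esub> \<notin> wreath_gens m k"
  using assms by (auto simp: wreath_gens_def wreath_gen_def wreath_elem_def one_wreath)

theorem theorem1:
  fixes k d :: nat
  assumes "odd k" and "k \<ge> 3" and "even d" and "d \<ge> 2"
  shows "\<exists>(\<Gamma> :: nat monoid) X.
           group \<Gamma> \<and> finite (carrier \<Gamma>) \<and>
           X \<subseteq> carrier \<Gamma> \<and> generate \<Gamma> X = carrier \<Gamma> \<and> \<one>\<^bsub>\<Gamma>\<^esub> \<notin> X \<and>
           order \<Gamma> = 2 * k * (d div 2) ^ k \<and>
           card X = d \<and>
           digraph_diameter (cayley_digraph \<Gamma> X) \<le> ereal (real k)"
proof -
  obtain n where k: "k = 2 * n + 1"
    using \<open>odd k\<close> by (rule oddE)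
  define m where "m = int (d div 2)"
  have n: "0 < n" and m: "0 < m"
    using assms k by (auto simp: m_def)
  let ?G = "wreath m (int k)" and ?X = "wreath_gens m (int k)"
  interpret group ?G
    using m assms(2) by (intro group_wreath) auto
  have X: "?X \<subseteq> carrier ?G"
    using gen_in_carrier[of m "int k"] m assms(2) by (auto simp: wreath_gens_def)
  have one: "\<one>\<^bsub>?G\<^esub> \<notin> ?X"
    using assms(2) by (intro one_notin_gens) auto
  have words: "\<exists>xs. length xs \<le> k \<and> set xs \<subseteq> ?X \<and> foldl (\<otimes>\<^bsub>?G\<^esub>) \<one>\<^bsub>?G\<^esub> xs = v"
    if v: "v \<in> carrier ?G" for v
  proof -
    have ik: "2 * int n + 1 = int k"
      by (simp add: k)
    from word_products[OF m n v[folded ik], unfolded ik] obtain xs where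
      "length xs = 2 * n + 1" and xs: "set xs \<subseteq> ?X" "foldl (\<otimes>\<^bsub>?G\<^esub>) \<one>\<^bsub>?G\<^esub> xs = v"
      by blast
    then have "length xs \<le> k"
      unfolding k by (simp only: order_refl)
    with xs show ?thesis by blast
  qed
  have order: "order ?G = 2 * k * (d div 2) ^ k"
    using order_wreath[of m "int k"] m assms(2) by (simp add: m_def)
  have card: "card ?X = d"
    using card_gens[of "int k" m] assms by (auto simp: m_def)
  show ?thesis
    using nat_cayley_digraph_of_words[OF finite_wreath X one words] unfolding order card .
qed

end
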